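(* Let $D=\{(\vec{y}_i,\vec{s}_i)\}_{i=1}^n$ be $n$ independent top-$m_i$ rank orderings ($1\le m_i\le n_i$) of subsets $\mathcal{K}_i\subseteq\mathcal{K}=\{1,\ldots,K\}$ with $|\mathcal{K}_i|=n_i\ge 2$, under the GPL model with parameters $\vec{\theta}=(\theta_1,\ldots,\theta_K)$, $0<\theta_k\le 1$, and write $\vec{m}=(m_1,\ldots,m_n)$. Then the likelihood has the closed forms $$p(D\mid\vec{\theta},\vec{m})=\prod_{i=1}^n\prod_{j=1}^{m_i^\star}\frac{\theta_{y_{ij}}\left\{\prod_{\ell=j+1}^{n_i}(1-\theta_{y_{i\ell}})\right\}^{1-t_{ij}}\left\{1-\prod_{\ell=j+1}^{n_i}(1-\theta_{y_{i\ell}})\right\}^{t_{ij}}}{1-\prod_{\ell=j}^{n_i}(1-\theta_{y_{i\ell}})}=\frac{\prod_{k=1}^K\theta_k^{w_k}(1-\theta_k)^{d_k}}{\prod_{i=1}^n\prod_{j=1}^{v_i}\left\{1-\prod_{\ell\in\mathcal{R}_{ij}}(1-\theta_\ell)\right\}},$$ where $m_i^\star=\min(m_i,n_i-1)$, $t_{ij}=\mathbb{I}(s_{ij}=s_{i,j+1})$, $v_i=s_{i m_i^\star}$, $\mathcal{R}_{ij}=\{y_{i\ell}: s_{i\ell}\ge j\}$, $\delta_{ijk}=\mathbb{I}(k\in\mathcal{R}_{ij})$, $d_k=\sum_{i=1}^n\sum_{j=2}^{s_{in_i}}\delta_{ijk}$ and $w_k=\sum_{i=1}^n\sum_{j=1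}^{v_i}\delta_{ijk}-d_k$.
   Context: $\mathbb{I}(A)$ is $1$ if $A$ is true and $0$ otherwise; the convention $x^0=1$ (including $0^0=1$) is used. Data encoding. In comparison $i$, the entities of $\mathcal{K}_i$ (with $|\mathcal{K}_i|=n_i$) are considered and the top $m_i$ are reported, possibly with ties. The list $\vec{y}_i=(y_{i1},\ldots,y_{in_i})$ enumerates $\mathcal{K}_i$: $y_{i1},\ldots,y_{im_i}$ are the reported entities from first-ranked downwards, and $y_{i,m_i+1},\ldots,y_{in_i}$ are the un-ranked entities in arbitrary order. The ordered set indicator $\vec{s}_i=(s_{i1},\ldots,s_{in_i})$ satisfies $s_{i1}=1$ and $s_{i,j+1}\in\{s_{ij},s_{ij}+1\}$ for $1\le j<m_i$; here $s_{ij}$ is the index of the ordered set ("bucket") containing $y_{ij}$, and $s_{ij}=s_{i,j+1}$ means that $y_{ij}$ and $y_{i,j+1}$ are tied. All un-ranked entities are assigned, purely for notational convenience, the value $s_{ij}=s_{im_i}+1$ for $j>m_i$ (this does not mean that they are tied with each other). The case $m_i=n_i$ is a complete rank ordering of $\mathcal{K}_i$. GPL (generalized, or geometric, Plackett-Luce) model. For each $i$ let $W_{ik}$, $k\in\mathcal{K}_i$, be independent with $W_{ik}\sim\mathrm{Geom}(\theta_k)$, i.e. $\Pr(W_{ik}=w)=(1-\theta_k)^{w-1}\theta_k$ for $w\in\{1,2,3,\ldots\}$. The probability $\Pr(\vec{Y}_i=\vec{y}_i,\vec{S}_i=\vec{s}_i\mid\vec{\theta},m_i)$ is the probability that the latent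 variables, arranged from smallest to largest, take the ordering $\vec{y}_i$ with ties defined by $\vec{s}_i$ up to position $m_i$: for each $1\le j<m_i$, $W_{iy_{ij}}=W_{iy_{i,j+1}}$ if $s_{ij}=s_{i,j+1}$ and $W_{iy_{ij}}<W_{iy_{i,j+1}}$ otherwise, and $W_{iy_{im_i}}<W_{iy_{i\ell}}$ for all $\ell>m_i$. The likelihood is $p(D\mid\vec{\theta},\vec{m})=\prod_{i=1}^n\Pr(\vec{Y}_i=\vec{y}_i,\vec{S}_i=\vec{s}_i\mid\vec{\theta},m_i)$. The set $\mathcal{R}_{ij}$ is the set of entities still available at stage $j$ of comparison $i$, i.e. those ranked at least as low as the $j$th ordered set. *)

theory Defs
  imports "HOL-Probability.Probability"
begin

text \<open>
  Positions and comparisons are indexed from 1. A comparison of the finite entity set \<open>E\<close>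
  is given by \<open>m\<close>, \<open>y\<close>, \<open>s\<close>, where \<open>y j\<close> and \<open>s j\<close> are relevant for
  \<open>1 \<le> j \<le> card E\<close> only.
\<close>

definition top_ranking :: "nat set \<Rightarrow> nat \<Rightarrow> (nat \<Rightarrow> nat) \<Rightarrow> (nat \<Rightarrow> nat) \<Rightarrow> bool" where
  "top_ranking E m y s \<longleftrightarrow>
     bij_betw y {1..card E} E \<and>
     s 1 = 1 \<and>
     (\<forall>j\<in>{1..<m}. s (j + 1) \<in> {s j, s j + 1}) \<and>
     (\<forall>j\<in>{m<..card E}. s j = s m + 1)"

text \<open>
  The library's \<open>geometric_pmf\<close> is supported on \<open>{0, 1, 2, \<dots>}\<close>; the latent variables
  live on \<open>{1, 2, 3, \<dots>}\<close>.
\<close>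

definition geom1_pmf :: "real \<Rightarrow> nat pmf" where
  "geom1_pmf p = map_pmf Suc (geometric_pmf p)"

lemma pmf_geom1:
  assumes "0 < p" "p \<le> 1" "1 \<le> w"
  shows "pmf (geom1_pmf p) w = (1 - p) ^ (w - 1) * p"
proof -
  obtain v where w: "w = Suc v" using assms(3) by (cases w) auto
  show ?thesis using assms by (simp add: w geom1_pmf_def pmf_map_inj')
qed

definition gpl_event ::
  "nat \<Rightarrow> nat \<Rightarrow> (nat \<Rightarrow> nat) \<Rightarrow> (nat \<Rightarrow> nat) \<Rightarrow> (nat \<Rightarrow> nat) \<Rightarrow> bool" where
  "gpl_event N m y s x \<longleftrightarrow>
     (\<forall>j\<in>{1..<m}. if s j = s (j + 1) then x (y j) = x (y (j + 1)) else x (y j) < x (y (j + 1))) \<and>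
     (\<forall>l\<in>{m<..N}. x (y m) < x (y l))"

definition gpl_prob ::
  "'a measure \<Rightarrow> (nat \<Rightarrow> 'a \<Rightarrow> nat) \<Rightarrow> nat \<Rightarrow> nat \<Rightarrow> (nat \<Rightarrow> nat) \<Rightarrow> (nat \<Rightarrow> nat) \<Rightarrow> real" where
  "gpl_prob M W N m y s = measure M {\<omega> \<in> space M. gpl_event N m y s (\<lambda>k. W k \<omega>)}"

definition gpl_likelihood ::
  "'a measure \<Rightarrow> (nat \<Rightarrow> nat \<Rightarrow> 'a \<Rightarrow> nat) \<Rightarrow> nat \<Rightarrow> (nat \<Rightarrow> nat) \<Rightarrow> (nat \<Rightarrow> nat)
     \<Rightarrow> (nat \<Rightarrow> nat \<Rightarrow> nat) \<Rightarrow> (nat \<Rightarrow> nat \<Rightarrow> nat) \<Rightarrow> real" where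
  "gpl_likelihood M W n N m y s = (\<Prod>i=1..n. gpl_prob M (W i) (N i) (m i) (y i) (s i))"

definition m_star :: "nat \<Rightarrow> nat \<Rightarrow> nat" where
  "m_star N m = min m (N - 1)"

definition tie :: "(nat \<Rightarrow> nat) \<Rightarrow> nat \<Rightarrow> nat" where
  "tie s j = of_bool (s j = s (j + 1))"

definition avail :: "nat \<Rightarrow> (nat \<Rightarrow> nat) \<Rightarrow> (nat \<Rightarrow> nat) \<Rightarrow> nat \<Rightarrow> nat set" where
  "avail N y s j = {y l | l. l \<in> {1..N} \<and> s l \<ge> j}"

definition in_avail :: "nat \<Rightarrow> (nat \<Rightarrow> nat) \<Rightarrow> (nat \<Rightarrow> nat) \<Rightarrow> nat \<Rightarrow> nat \<Rightarrow> nat" where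
  "in_avail N y s j k = of_bool (k \<in> avail N y s j)"

definition num_stages :: "nat \<Rightarrow> nat \<Rightarrow> (nat \<Rightarrow> nat) \<Rightarrow> nat" where
  "num_stages N m s = s (m_star N m)"

definition d_exp ::
  "nat \<Rightarrow> (nat \<Rightarrow> nat) \<Rightarrow> (nat \<Rightarrow> nat \<Rightarrow> nat) \<Rightarrow> (nat \<Rightarrow> nat \<Rightarrow> nat) \<Rightarrow> nat \<Rightarrow> nat" where
  "d_exp n N y s k = (\<Sum>i=1..n. \<Sum>j=2..s i (N i). in_avail (N i) (y i) (s i) j k)"

text \<open>Integer-valued, so that the subtraction is not truncated.\<close>

definition w_exp ::
  "nat \<Rightarrow> (nat \<Rightarrow> nat) \<Rightarrow> (nat \<Rightarrow> nat) \<Rightarrow> (nat \<Rightarrow> nat \<Rightarrow> nat) \<Rightarrow> (nat \<Rightarrow> nat \<Rightarrow> nat)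
     \<Rightarrow> nat \<Rightarrow> int" where
  "w_exp n N m y s k =
     int (\<Sum>i=1..n. \<Sum>j=1..num_stages (N i) (m i) (s i). in_avail (N i) (y i) (s i) j k)
     - int (d_exp n N y s k)"

end

(*
  The constraints are peeled off from the first position. Let Q_j be the product of 1 - \<theta>_l over the
  positions l \<ge> j, and let E_j be the event that the constraints between the positions from j on hold.
  The least of the variables at positions \<ge> j is geometric with failure probability Q_j and is
  independent of the order pattern, so P(E_j, X_j = w) = P(E_j) (1 - Q_j) Q_j^(w-1). By downward
  induction on j, conditioning on X_j multiplies P(E_(j+1)) by the j-th factor of the first product:
  a tie requires X_(j+1) = w, a strict step X_(j+1) > w, whose probability is a geometric tail.

  The second form is a rearrangement within each comparison: a tie at j cancels 1 - Q_(j+1) against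
  the next denominator, so only the denominators at starts of buckets survive, and
  1 - \<theta>_l is collected once for every strict step before l.
*)
theory Submission
  imports Defs
begin

section \<open>Independence and geometric tails\<close>

lemma (in prob_space) indep_vars_reindex_inj:
  assumes f: "inj_on f J" "f ` J \<subseteq> I"
    and X: "indep_vars M' X I"
  shows "indep_vars (\<lambda>j. M' (f j)) (\<lambda>j. X (f j)) J"
  unfolding indep_vars_def2 indep_sets_def
proof (intro conjI ballI allI impI)
  fix j assume j: "j \<in> J"
  then show rv: "random_variable (M' (f j)) (X (f j))"
    using X f(2) by (auto simp: indep_vars_def2)
  show "{X (f j) -` A \<inter> space M |A. A \<in> sets (M' (f j))} \<subseteq> events"
    using rv by (auto simp: measurable_def)
next
  fix L A
  assume L: "L \<subseteq> J" "L \<noteq> {}" "finite L"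
    and A: "A \<in> (\<Pi> j\<in>L. {X (f j) -` A \<inter> space M |A. A \<in> sets (M' (f j))})"
  define g where "g = the_inv_into J f"
  have g: "g (f j) = j" if "j \<in> L" for j
    using that f(1) L(1) by (auto simp: g_def the_inv_into_f_f)
  have inj: "inj_on f L"
    using f(1) L(1) by (rule inj_on_subset)
  have "indep_sets (\<lambda>i. {X i -` A \<inter> space M |A. A \<in> sets (M' i)}) I"
    using X by (simp add: indep_vars_def2)
  then have "prob (\<Inter>i\<in>f ` L. A (g i)) = (\<Prod>i\<in>f ` L. prob (A (g i)))"
    by (rule indep_setsD) (use L f(2) A g in \<open>auto simp: Pi_iff\<close>)
  then show "prob (\<Inter>j\<in>L. A j) = (\<Prod>j\<in>L. prob (A j))"
    using inj g by (simp add: prod.reindex image_image cong: INF_cong prod.cong)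
qed

text \<open>The tail is the disjoint union of the slices \<open>X = Suc (w + k)\<close>, and their
  measures form a geometric series. The event \<open>A\<close> is arbitrary, so it may carry the
  order pattern of later positions.\<close>

lemma geom_tail:
  fixes X :: "'a \<Rightarrow> nat"
  assumes "finite_measure M" and X: "X \<in> measurable M (count_space UNIV)" and A: "A \<in> sets M"
    and Q: "0 \<le> Q" "Q < 1"
    and point: "\<And>v. 1 \<le> v \<Longrightarrow> measure M {\<omega> \<in> A. X \<omega> = v} = g * (1 - Q) * Q ^ (v - 1)"
  shows "measure M {\<omega> \<in> A. w < X \<omega>} = g * Q ^ w"
proof -
  interpret finite_measure M by fact
  let ?B = "\<lambda>k. {\<omega> \<in> A. X \<omega> = Suc (w + k)}"
  have ev: "?B k \<in> sets M" for k
  proof -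
    have "?B k = A \<inter> (X -` {Suc (w + k)} \<inter> space M)"
      using sets.sets_into_space[OF A] by auto
    then show ?thesis using A X by (auto intro: measurable_sets)
  qed
  have "(\<lambda>k. measure M (?B k)) sums measure M (\<Union>k. ?B k)"
    by (rule finite_measure_UNION) (use ev in \<open>auto simp: disjoint_family_on_def\<close>)
  moreover have "(\<Union>k. ?B k) = {\<omega> \<in> A. w < X \<omega>}"
    by (auto dest: less_imp_Suc_add)
  moreover have "measure M (?B k) = g * (1 - Q) * Q ^ w * Q ^ k" for k
    by (simp add: point power_add)
  ultimately have "(\<lambda>k. g * (1 - Q) * Q ^ w * Q ^ k) sums measure M {\<omega> \<in> A. w < X \<omega>}"
    by simp
  moreover have "(\<lambda>k. g * (1 - Q) * Q ^ w * Q ^ k) sums (g * (1 - Q) * Q ^ w * (1 / (1 - Q)))"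
    using Q by (intro sums_mult geometric_sums) simp
  ultimately show ?thesis
    using Q sums_unique2 by fastforce
qed

text \<open>The first factor is strictly below 1 and the others are at most 1. This keeps every
  denominator nonzero and every geometric series convergent.\<close>

lemma suffix_prod_less_1:
  fixes q :: "nat \<Rightarrow> real"
  assumes "\<And>l. l \<in> {1..N} \<Longrightarrow> 0 \<le> q l \<and> q l < 1" "1 \<le> j" "j \<le> N"
  shows "0 \<le> prod q {j..N} \<and> prod q {j..N} < 1"
proof -
  have *: "prod q {j..N} = q j * prod q {Suc j..N}"
    using assms by (simp add: prod.atLeast_Suc_atMost)
  have q: "0 \<le> q l \<and> q l \<le> 1" if "l \<in> {Suc j..N}" for l
    using assms(1)[of l] assms(2) that by auto
  then have "prod q {Suc j..N} \<le> 1" "0 \<le> prod q {Suc j..N}"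
    by (auto intro: prod_le_1 prod_nonneg)
  moreover have "0 \<le> q j" "q j < 1"
    using assms by auto
  ultimately have "q j * prod q {Suc j..N} \<le> q j" "0 \<le> q j * prod q {Suc j..N}"
    by (auto intro: mult_left_le)
  with * \<open>q j < 1\<close> show ?thesis by linarith
qed

section \<open>Probability of a single top-m ranking\<close>

definition stage_factor :: "(nat \<Rightarrow> real) \<Rightarrow> nat \<Rightarrow> (nat \<Rightarrow> nat) \<Rightarrow> nat \<Rightarrow> real" where
  "stage_factor p N s j =
     p j * (\<Prod>l=j+1..N. 1 - p l) ^ (1 - tie s j) * (1 - (\<Prod>l=j+1..N. 1 - p l)) ^ tie s j
     / (1 - (\<Prod>l=j..N. 1 - p l))"

text \<open>This is \<open>gpl_event\<close> with the variables indexed by position instead of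
  entity, restricted to the constraints from position \<open>a\<close> on. For \<open>a = m\<close>
  only the inequalities against the un-ranked positions remain.\<close>

definition suffix_event :: "nat \<Rightarrow> nat \<Rightarrow> (nat \<Rightarrow> nat) \<Rightarrow> nat \<Rightarrow> (nat \<Rightarrow> nat) \<Rightarrow> bool" where
  "suffix_event N m s a x \<longleftrightarrow>
     (\<forall>j\<in>{a..<m}. if s j = s (j + 1) then x j = x (j + 1) else x j < x (j + 1)) \<and>
     (\<forall>l\<in>{m<..N}. x m < x l)"

lemma suffix_event_cong:
  assumes "\<And>l. l \<in> {a..N} \<Longrightarrow> f l = g l" "a \<le> m" "m \<le> N"
  shows "suffix_event N m s a f = suffix_event N m s a g"
  unfolding suffix_event_def
  by (intro arg_cong2[of _ _ _ _ "(\<and>)"] ball_cong refl) (use assms in simp_all)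

lemma suffix_event_measurable:
  assumes X: "\<And>l. l \<in> {a..N} \<Longrightarrow> X l \<in> measurable M (count_space (UNIV :: nat set))"
    and "a \<le> m" "m \<le> N"
  shows "{\<omega> \<in> space M. suffix_event N m s a (\<lambda>l. X l \<omega>)} \<in> sets M"
proof -
  \<comment> \<open>Since the first variable takes countably many values, it suffices to fix its
    value \<open>v\<close> and vary the second.\<close>
  have cmp: "Measurable.pred M (\<lambda>\<omega>. R (X i \<omega>) (X j \<omega>))"
    if "i \<in> {a..N}" "j \<in> {a..N}" for i j and R :: "nat \<Rightarrow> nat \<Rightarrow> bool"
    by (rule measurable_compose_countable[where f = "\<lambda>v \<omega>. R v (X j \<omega>)"])
      (rule measurable_compose[OF X[OF that(2)]], simp, rule X[OF that(1)])
  have "Measurable.pred M (\<lambda>\<omega>. if s j = s (j + 1) then X j \<omega> = X (j + 1) \<omega> else X j \<omega> < X (j + 1) \<omega>)"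
    if "j \<in> {a..<m}" for j
    using that assms(2,3) cmp[of j "j + 1" "(=)"] cmp[of j "j + 1" "(<)"] by auto
  moreover have "Measurable.pred M (\<lambda>\<omega>. X m \<omega> < X l \<omega>)" if "l \<in> {m<..N}" for l
    using that assms(2,3) cmp[of m l "(<)"] by auto
  ultimately show ?thesis
    unfolding suffix_event_def by (simp add: pred_def[symmetric])
qed

text \<open>The restrictions of \<open>X\<close> to the disjoint blocks \<open>{a}\<close> and
  \<open>J\<close> are independent. The hypothesis \<open>local\<close> says that \<open>P\<close>
  looks only at \<open>J\<close>, so it may be evaluated at the restricted vector.\<close>

lemma (in prob_space) indep_vars_prob_split:
  assumes indep: "indep_vars (\<lambda>_. count_space UNIV) X I"
    and J: "a \<in> I" "J \<subseteq> I" "a \<notin> J"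
    and meas: "{f \<in> space (PiM J (\<lambda>_. count_space UNIV)). P f} \<in> sets (PiM J (\<lambda>_. count_space UNIV))"
    and local: "\<And>f g. (\<And>l. l \<in> J \<Longrightarrow> f l = g l) \<Longrightarrow> P f = P g"
  shows "prob {\<omega> \<in> space M. X a \<omega> = w \<and> P (\<lambda>l. X l \<omega>)} =
         prob {\<omega> \<in> space M. X a \<omega> = w} * prob {\<omega> \<in> space M. P (\<lambda>l. X l \<omega>)}"
proof -
  let ?R = "\<lambda>A \<omega>. restrict (\<lambda>i. X i \<omega>) A"
  let ?S = "{f \<in> space (PiM {a} (\<lambda>_. count_space UNIV)). f a = w}"
  let ?T = "{f \<in> space (PiM J (\<lambda>_. count_space UNIV)). P f}"
  have S: "?S \<in> sets (PiM {a} (\<lambda>_. count_space UNIV))"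
    by measurable
  have "indep_var (PiM {a} (\<lambda>_. count_space UNIV)) (?R {a}) (PiM J (\<lambda>_. count_space UNIV)) (?R J)"
    by (rule indep_var_restrict[OF indep]) (use J in auto)
  from indep_varD[OF this S meas]
  have "prob ((\<lambda>\<omega>. (?R {a} \<omega>, ?R J \<omega>)) -` (?S \<times> ?T) \<inter> space M) =
        prob (?R {a} -` ?S \<inter> space M) * prob (?R J -` ?T \<inter> space M)" .
  moreover have "P (?R J \<omega>) = P (\<lambda>l. X l \<omega>)" for \<omega>
    by (rule local) simp
  then have "?R J -` ?T \<inter> space M = {\<omega> \<in> space M. P (\<lambda>l. X l \<omega>)}"
    "?R {a} -` ?S \<inter> space M = {\<omega> \<in> space M. X a \<omega> = w}"
    "(\<lambda>\<omega>. (?R {a} \<omega>, ?R J \<omega>)) -` (?S \<times> ?T) \<inter> space M =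
       {\<omega> \<in> space M. X a \<omega> = w \<and> P (\<lambda>l. X l \<omega>)}"
    by (auto simp: space_PiM)
  ultimately show ?thesis by simp
qed

lemma (in prob_space) prob_geom_ranking:
  fixes X :: "nat \<Rightarrow> 'a \<Rightarrow> nat"
  assumes indep: "indep_vars (\<lambda>_. count_space UNIV) X {1..N}"
    and p: "\<And>l. l \<in> {1..N} \<Longrightarrow> 0 < p l \<and> p l \<le> 1"
    and law: "\<And>l w. l \<in> {1..N} \<Longrightarrow> prob {\<omega> \<in> space M. X l \<omega> = w} = pmf (geom1_pmf (p l)) w"
    and m: "1 \<le> m" "m \<le> N"
    and last: "m < N \<Longrightarrow> s m \<noteq> s (m + 1)"
  shows "prob {\<omega> \<in> space M. suffix_event N m s 1 (\<lambda>l. X l \<omega>)} =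
         (\<Prod>j=1..m_star N m. stage_factor p N s j)"
proof -
  let ?q = "\<lambda>l. 1 - p l"
  define Q where "Q j = (\<Prod>l=j..N. 1 - p l)" for j
  \<comment> \<open>\<open>G j\<close> will be the probability of \<open>Ev j\<close>. Its last
    factor, the probability that position \<open>m\<close> lies strictly below all later ones, is
    kept apart because for \<open>m = N\<close> it is 1 and not a stage factor.\<close>
  define G where "G j = (\<Prod>i=j..<m. stage_factor p N s i) * (p m * Q (m + 1) / (1 - Q m))" for j
  define Ev where "Ev j = {\<omega> \<in> space M. suffix_event N m s j (\<lambda>l. X l \<omega>)}" for j
  have rv: "X l \<in> measurable M (count_space UNIV)" if "l \<in> {1..N}" for l
    using indep that by (auto simp: indep_vars_def2)
  have Ev: "Ev j \<in> events" if "j \<in> {1..m}" for j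
    unfolding Ev_def using that m by (intro suffix_event_measurable rv) auto
  have Q: "0 \<le> Q j" "Q j < 1" if "j \<in> {1..N}" for j
    using suffix_prod_less_1[of N ?q j] p that by (auto simp: Q_def)
  have Q_Suc: "Q j = (1 - p j) * Q (j + 1)" if "j \<le> N" for j
    using that by (simp add: Q_def prod.atLeast_Suc_atMost)
  have pt: "prob {\<omega> \<in> space M. X l \<omega> = w} = p l * (1 - p l) ^ (w - 1)"
    if "l \<in> {1..N}" "1 \<le> w" for l w
    using that p by (simp add: law pmf_geom1)
  have tail: "prob (X l -` {w<..} \<inter> space M) = (1 - p l) ^ w" if l: "l \<in> {1..N}" for l w
  proof -
    have "prob {\<omega> \<in> space M. w < X l \<omega>} = 1 * (1 - p l) ^ w"
      by (rule geom_tail) (use l p[OF l] pt rv in \<open>auto intro: finite_measure_axioms\<close>)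
    then show ?thesis by (simp add: vimage_def Collect_conj_eq Int_commute)
  qed
  \<comment> \<open>The joint law with \<open>X j\<close> is carried through the induction, because
    the constraint added one position earlier compares with that value. On \<open>Ev j\<close> the
    variable \<open>X j\<close> is the minimum over the positions from \<open>j\<close> on.\<close>
  have claim: "\<forall>w\<ge>1. prob {\<omega> \<in> Ev j. X j \<omega> = w} = G j * (1 - Q j) * Q j ^ (w - 1)"
    if "1 \<le> j" "j \<le> m" for j
    using that(2,1)
  proof (induction j rule: inc_induct)
    case base
    show ?case
    proof (intro allI impI)
      fix w :: nat assume w: "1 \<le> w"
      \<comment> \<open>With \<open>X m\<close> fixed to \<open>w\<close> the event is a box, so its
        probability factorizes over the positions.\<close>
      define A where "A l = (if l = m then {w} else {w<..})" for l
      have "{m..N} = insert m {m<..N}" using m by auto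
      then have "{\<omega> \<in> Ev m. X m \<omega> = w} = (\<Inter>l\<in>{m..N}. X l -` A l \<inter> space M)"
        by (auto simp: Ev_def suffix_event_def A_def)
      also have "prob \<dots> = (\<Prod>l\<in>{m..N}. prob (X l -` A l \<inter> space M))"
        by (rule indep_varsD[OF indep]) (use m in auto)
      also have "\<dots> = prob (X m -` {w} \<inter> space M) * (\<Prod>l\<in>{m+1..N}. prob (X l -` {w<..} \<inter> space M))"
        using m by (simp add: prod.atLeast_Suc_atMost A_def)
      also have "\<dots> = p m * (1 - p m) ^ (w - 1) * (\<Prod>l\<in>{m+1..N}. (1 - p l) ^ w)"
      proof -
        have "prob (X m -` {w} \<inter> space M) = p m * (1 - p m) ^ (w - 1)"
          using m pt[of m w] w by (simp add: vimage_def Collect_conj_eq Int_commute)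
        moreover have "(\<Prod>l\<in>{m+1..N}. prob (X l -` {w<..} \<inter> space M)) = (\<Prod>l\<in>{m+1..N}. (1 - p l) ^ w)"
          by (rule prod.cong[OF refl tail]) auto
        ultimately show ?thesis by simp
      qed
      \<comment> \<open>One factor \<open>Q (m + 1)\<close> goes into \<open>G m\<close>; the other
        \<open>w - 1\<close> combine with the powers of \<open>1 - p m\<close> into
        \<open>Q m ^ (w - 1)\<close>.\<close>
      also have "\<dots> = p m * (1 - p m) ^ (w - 1) * (Q (m + 1) ^ Suc (w - 1))"
        using w by (simp add: Q_def prod_power_distrib)
      also have "\<dots> = G m * (1 - Q m) * Q m ^ (w - 1)"
        using Q[of m] Q_Suc[of m] m by (simp add: G_def power_mult_distrib)
      finally show "prob {\<omega> \<in> Ev m. X m \<omega> = w} = G m * (1 - Q m) * Q m ^ (w - 1)" .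
    qed
  next
    case (step j)
    then have IH: "\<And>w. 1 \<le> w \<Longrightarrow> prob {\<omega> \<in> Ev (Suc j). X (Suc j) \<omega> = w} =
        G (Suc j) * (1 - Q (Suc j)) * Q (Suc j) ^ (w - 1)" by simp
    have jN: "j \<in> {1..N}" "Suc j \<in> {1..N}" "Suc j \<in> {1..m}" using step m by auto
    have G_Suc: "G j = stage_factor p N s j * G (Suc j)"
      using step by (simp add: G_def prod.atLeast_Suc_lessThan)
    have sf: "stage_factor p N s j * (1 - Q j) =
        p j * Q (Suc j) ^ (1 - tie s j) * (1 - Q (Suc j)) ^ tie s j"
      using Q[OF jN(1)] by (simp add: stage_factor_def Q_def)
    show ?case
    proof (intro allI impI)
      fix w :: nat assume w: "1 \<le> w"
      \<comment> \<open>The constraint at \<open>j\<close> with \<open>X j\<close> replaced by the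
        constant \<open>w\<close>: now \<open>?P\<close> depends on the positions after
        \<open>j\<close> only and is independent of \<open>X j\<close>.\<close>
      let ?rel = "\<lambda>v. if s j = s (j + 1) then w = v else w < v"
      let ?P = "\<lambda>f. suffix_event N m s (Suc j) f \<and> ?rel (f (Suc j))"
      let ?Pi = "PiM {Suc j..N} (\<lambda>_. count_space (UNIV :: nat set))"
      have meas: "{f \<in> space ?Pi. ?P f} \<in> sets ?Pi"
      proof -
        have "{f \<in> space ?Pi. suffix_event N m s (Suc j) (\<lambda>l. f l)} \<in> sets ?Pi"
          by (rule suffix_event_measurable) (use step m in \<open>auto intro!: measurable_component_singleton\<close>)
        moreover have "{f \<in> space ?Pi. ?rel (f (Suc j))} \<in> sets ?Pi"
        proof -
          have "(\<lambda>f. f (Suc j)) -` {v. ?rel v} \<inter> space ?Pi \<in> sets ?Pi"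
            by (rule measurable_sets[OF measurable_component_singleton]) (use jN in auto)
          then show ?thesis by (simp add: vimage_def Collect_conj_eq Int_commute)
        qed
        ultimately show ?thesis by (intro sets.sets_Collect_conj)
      qed
      have local: "?P f = ?P g" if eq: "\<And>l. l \<in> {Suc j..N} \<Longrightarrow> f l = g l" for f g
        using suffix_event_cong[of "Suc j" N f g m s] eq[of "Suc j"] eq step m jN by simp
      have "prob {\<omega> \<in> space M. ?P (\<lambda>l. X l \<omega>)} = prob {\<omega> \<in> Ev (Suc j). ?rel (X (Suc j) \<omega>)}"
        by (simp only: Ev_def mem_Collect_eq conj_assoc)
      also have "\<dots> = G (Suc j) * Q (Suc j) ^ (1 - tie s j) * (1 - Q (Suc j)) ^ tie s j * Q (Suc j) ^ (w - 1)"
      proof (cases "s j = s (j + 1)")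
        case True
        then show ?thesis using IH[OF w] by (simp add: tie_def eq_commute[of w])
      next
        case False
        have "prob {\<omega> \<in> Ev (Suc j). w < X (Suc j) \<omega>} = G (Suc j) * Q (Suc j) ^ w"
          by (rule geom_tail[OF finite_measure_axioms rv[OF jN(2)] Ev[OF jN(3)] Q[OF jN(2)] IH])
        \<comment> \<open>The split-off factor belongs to the stage factor of a strict step; the
          remaining power later joins that of \<open>1 - p j\<close>.\<close>
        moreover have "Q (Suc j) ^ w = Q (Suc j) * Q (Suc j) ^ (w - 1)"
          using w by (simp add: power_eq_if)
        ultimately show ?thesis using False by (simp add: tie_def)
      qed
      finally have rest: "prob {\<omega> \<in> space M. ?P (\<lambda>l. X l \<omega>)} =
          G (Suc j) * Q (Suc j) ^ (1 - tie s j) * (1 - Q (Suc j)) ^ tie s j * Q (Suc j) ^ (w - 1)" .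
      have "{j..<m} = insert j {Suc j..<m}" using step by auto
      then have "prob {\<omega> \<in> Ev j. X j \<omega> = w} = prob {\<omega> \<in> space M. X j \<omega> = w \<and> ?P (\<lambda>l. X l \<omega>)}"
        by (simp add: Ev_def suffix_event_def conj_ac cong: conj_cong)
      also have "\<dots> = prob {\<omega> \<in> space M. X j \<omega> = w} * prob {\<omega> \<in> space M. ?P (\<lambda>l. X l \<omega>)}"
      proof (rule indep_vars_prob_split[OF indep])
        show "j \<in> {1..N}" by fact
        show "{Suc j..N} \<subseteq> {1..N}" "j \<notin> {Suc j..N}" by auto
        show "{f \<in> space ?Pi. ?P f} \<in> sets ?Pi" by (fact meas)
      qed (fact local)
      also have "\<dots> = p j * (1 - p j) ^ (w - 1) *
          (G (Suc j) * Q (Suc j) ^ (1 - tie s j) * (1 - Q (Suc j)) ^ tie s j * Q (Suc j) ^ (w - 1))"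
        by (simp only: rest pt[OF jN(1) w])
      also have "\<dots> = G (Suc j) * (stage_factor p N s j * (1 - Q j)) * Q j ^ (w - 1)"
      proof -
        have "Q j ^ (w - 1) = (1 - p j) ^ (w - 1) * Q (Suc j) ^ (w - 1)"
          using Q_Suc[of j] jN by (simp add: power_mult_distrib)
        then show ?thesis by (simp add: sf)
      qed
      also have "\<dots> = G j * (1 - Q j) * Q j ^ (w - 1)"
        by (simp add: G_Suc)
      finally show "prob {\<omega> \<in> Ev j. X j \<omega> = w} = G j * (1 - Q j) * Q j ^ (w - 1)" .
    qed
  qed
  have one: "1 \<in> {1..N}" "1 \<in> {1..m}" using m by auto
  \<comment> \<open>\<open>geom_tail\<close> at \<open>w = 0\<close> gives the probability of
    \<open>Ev 1\<close> together with \<open>0 < X 1\<close>. The second condition holds almost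
    surely because the shifted geometric law has no mass at 0.\<close>
  have "prob {\<omega> \<in> space M. X 1 \<omega> = 0} = 0"
    using one by (auto simp: law geom1_pmf_def pmf_eq_0_set_pmf)
  then have "AE \<omega> in M. 0 < X 1 \<omega>"
    using rv[OF one(1)] by (subst AE_iff_measurable[OF _ refl]) (auto simp: emeasure_eq_measure)
  moreover have "{\<omega> \<in> Ev 1. 0 < X 1 \<omega>} = Ev 1 \<inter> (X 1 -` {0<..} \<inter> space M)"
    by (auto simp: Ev_def)
  then have "{\<omega> \<in> Ev 1. 0 < X 1 \<omega>} \<in> events"
    using Ev[OF one(2)] rv[OF one(1)] by (auto intro: measurable_sets)
  ultimately have "prob (Ev 1) = prob {\<omega> \<in> Ev 1. 0 < X 1 \<omega>}"
    using Ev[OF one(2)] by (intro finite_measure_eq_AE) auto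
  also have "\<dots> = G 1 * Q 1 ^ 0"
    by (rule geom_tail) (use finite_measure_axioms rv Ev one claim m Q in auto)
  also have "\<dots> = (\<Prod>j=1..m_star N m. stage_factor p N s j)"
  \<comment> \<open>For \<open>m < N\<close> the step at \<open>m\<close> is strict, so the extra
    factor of \<open>G\<close> is the stage factor at \<open>m\<close>. For \<open>m = N\<close> the
    product \<open>Q (m + 1)\<close> is empty and \<open>1 - Q m = p m\<close>, so the extra factor
    is 1 and the product stops at \<open>N - 1\<close>.\<close>
  proof (cases "m < N")
    case True
    then have "p m * Q (m + 1) / (1 - Q m) = stage_factor p N s m"
      using last by (simp add: stage_factor_def Q_def tie_def)
    moreover have "{1..m} = insert m {1..<m}" using m by auto
    ultimately show ?thesis using True by (simp add: G_def m_star_def min_def mult.commute)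
  next
    case False
    then have "m = N" using m by simp
    then have "p m * Q (m + 1) / (1 - Q m) = 1"
      using p[of m] m by (simp add: Q_def)
    then have "G 1 = (\<Prod>i=1..<m. stage_factor p N s i)"
      by (simp only: G_def mult_1_right)
    moreover have "{1..m_star N m} = {1..<m}"
      using \<open>m = N\<close> m by (auto simp: m_star_def)
    ultimately show ?thesis by simp
  qed
  finally show ?thesis by (simp add: Ev_def)
qed

section \<open>Rearranging the product within one comparison\<close>

text \<open>
  Here \<open>r\<close> plays the role of \<open>m\<^sup>\<star>\<close>. The common bucket index of the un-ranked entities makes every
  later position count as a tie, and \<open>r\<close> itself can only be tied in a complete ranking.
\<close>
locale bucket_sequence =
  fixes N r :: nat and s :: "nat \<Rightarrow> nat"
  assumes r: "1 \<le> r" "r < N"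
    and s_1: "s 1 = 1"
    and s_step: "\<And>j. j \<in> {1..<N} \<Longrightarrow> s (j + 1) = s j + (1 - tie s j)"
    and tie_after: "\<And>j. j \<in> {r<..<N} \<Longrightarrow> tie s j = 1"
    and tie_last: "tie s r \<noteq> 0 \<Longrightarrow> r + 1 = N"
begin

lemma s_mono: "s i \<le> s j" if "1 \<le> i" "i \<le> j" "j \<le> N"
  using that(2,1,3) by (induction j rule: dec_induct) (use s_step in auto)

lemma s_ge_1: "1 \<le> s l" if "l \<in> {1..N}"
  using s_mono[of 1 l] s_1 that by auto

lemma s_after: "s l = s (r + 1)" if "r < l" "l \<le> N"
proof -
  have "r + 1 \<le> l" using that by simp
  then show ?thesis using that(2)
    by (induction l rule: dec_induct) (use s_step tie_after in auto)
qed

lemma s_eq_sum: "s l = 1 + (\<Sum>j=1..<l. 1 - tie s j)" if "1 \<le> l" "l \<le> N"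
  using that
proof (induction l rule: dec_induct)
  case (step l)
  then show ?case using s_step[of l] by simp
qed (use s_1 in simp)

text \<open>\<open>s l - 1\<close> counts the strict steps before \<open>l\<close>. None lies beyond
  \<open>r\<close>, so the range of summation can be made independent of \<open>l\<close>, ready for
  exchanging products.\<close>

lemma s_eq_sum_upto_r: "s l - 1 = (\<Sum>j=1..r. if j < l then 1 - tie s j else 0)" if "l \<in> {1..N}"
proof -
  have "s l - 1 = (\<Sum>j=1..<l. 1 - tie s j)"
    using s_eq_sum that by simp
  also have "\<dots> = (\<Sum>j\<in>{1..r} \<inter> {j. j < l}. 1 - tie s j)"
  proof (rule sum.mono_neutral_right)
    show "\<forall>j\<in>{1..<l} - {1..r} \<inter> {j. j < l}. 1 - tie s j = 0"
    proof
      fix j assume "j \<in> {1..<l} - {1..r} \<inter> {j. j < l}"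
      then have "j \<in> {r<..<N}" using that by auto
      then show "1 - tie s j = 0" by (simp add: tie_after)
    qed
  qed (use r in auto)
  also have "\<dots> = (\<Sum>j=1..r. if j < l then 1 - tie s j else 0)"
    by (subst sum.inter_restrict) auto
  finally show ?thesis .
qed

text \<open>Each suffix product is extended to all positions by exponents 0. After exchanging the
  two products, the exponent of \<open>q l\<close> is the number of strict steps before
  \<open>l\<close>.\<close>

lemma prod_strict_suffix:
  fixes q :: "nat \<Rightarrow> real"
  shows "(\<Prod>j=1..r. prod q {j+1..N} ^ (1 - tie s j)) = (\<Prod>l=1..N. q l ^ (s l - 1))"
proof -
  have "prod q {j+1..N} ^ (1 - tie s j) = (\<Prod>l=1..N. q l ^ (if j < l then 1 - tie s j else 0))"
    if "j \<in> {1..r}" for j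
  proof -
    have "{j+1..N} = {1..N} \<inter> {l. j < l}" using that by auto
    then have "prod q {j+1..N} ^ (1 - tie s j) = (\<Prod>l\<in>{1..N} \<inter> {l. j < l}. q l ^ (1 - tie s j))"
      by (simp add: prod_power_distrib)
    also have "\<dots> = (\<Prod>l=1..N. if j < l then q l ^ (1 - tie s j) else 1)"
      by (subst prod.inter_restrict) auto
    finally show ?thesis by (simp add: if_distrib cong: if_cong)
  qed
  then have "(\<Prod>j=1..r. prod q {j+1..N} ^ (1 - tie s j)) =
      (\<Prod>j=1..r. \<Prod>l=1..N. q l ^ (if j < l then 1 - tie s j else 0))"
    by (rule prod.cong[OF refl])
  also have "\<dots> = (\<Prod>l=1..N. \<Prod>j=1..r. q l ^ (if j < l then 1 - tie s j else 0))"
    by (rule prod.swap)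
  also have "\<dots> = (\<Prod>l=1..N. q l ^ (s l - 1))"
    by (rule prod.cong[OF refl]) (simp only: power_sum s_eq_sum_upto_r)
  finally show ?thesis .
qed

text \<open>A telescoping product: the numerator of a tie at \<open>a\<close> stays pending and
  cancels the denominator at \<open>a + 1\<close>. After a strict step a bucket starts at
  \<open>a + 1\<close>, and its denominator survives.\<close>

lemma prod_tied_suffix:
  fixes q :: "nat \<Rightarrow> real"
  assumes q: "\<And>l. l \<in> {1..N} \<Longrightarrow> 0 \<le> q l \<and> q l < 1"
    and "1 \<le> a" "a \<le> r"
  shows "(\<Prod>j=1..a. (1 - prod q {j+1..N}) ^ tie s j / (1 - prod q {j..N})) =
         (1 - prod q {a+1..N}) ^ tie s a / (\<Prod>b=1..s a. 1 - prod q {l \<in> {1..N}. b \<le> s l})"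
  using assms(2,3)
proof (induction a rule: dec_induct)
  case base
  have "{l \<in> {1..N}. 1 \<le> s l} = {1..N}"
    using s_ge_1 by auto
  then show ?case using s_1 by simp
next
  case (step a)
  have aN: "a \<in> {1..<N}" using step r by auto
  have ne: "1 - prod q {a+1..N} \<noteq> 0"
    using suffix_prod_less_1[of N q "a + 1"] q aN by auto
  have IH: "(\<Prod>j=1..a. (1 - prod q {j+1..N}) ^ tie s j / (1 - prod q {j..N})) =
         (1 - prod q {a+1..N}) ^ tie s a / (\<Prod>b=1..s a. 1 - prod q {l \<in> {1..N}. b \<le> s l})"
    using step by simp
  show ?case
  proof (cases "tie s a = 0")
    case True
    then have s_Suc: "s (Suc a) = Suc (s a)" using s_step[OF aN] by simp
    \<comment> \<open>As the step at \<open>a\<close> is strict and \<open>s\<close> is monotone,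
      the positions in the new bucket or later form exactly the suffix after
      \<open>a\<close>.\<close>
    have "{l \<in> {1..N}. Suc (s a) \<le> s l} = {a+1..N}"
    proof (intro set_eqI iffI)
      fix l assume l: "l \<in> {l \<in> {1..N}. Suc (s a) \<le> s l}"
      then have "\<not> l \<le> a" using s_mono[of l a] aN by auto
      then show "l \<in> {a+1..N}" using l by auto
    next
      fix l assume "l \<in> {a+1..N}"
      then show "l \<in> {l \<in> {1..N}. Suc (s a) \<le> s l}" using s_mono[of "Suc a" l] s_Suc by auto
    qed
    then show ?thesis using IH True by (simp add: s_Suc)
  next
    case False
    then have "tie s a = 1" by (simp add: tie_def split: if_splits)
    moreover from this have "s (Suc a) = s a" using s_step[OF aN] by simp
    ultimately show ?thesis using IH ne by simp
  qed
qed

text \<open>The exponent is 1 up to the bucket of \<open>r\<close> and 0 in a later one. If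
  \<open>r\<close> is tied, then \<open>r + 1 = N\<close> and the pending numerator is
  \<open>1 - (1 - p N) = p N\<close>, the missing factor of position \<open>N\<close>.\<close>

lemma prod_powi_bucket:
  fixes p :: "nat \<Rightarrow> real"
  shows "(\<Prod>j=1..r. p j) * (1 - (\<Prod>l=r+1..N. 1 - p l)) ^ tie s r =
         (\<Prod>l=1..N. p l powi (int (min (s r) (s l)) - int (s l - 1)))"
proof -
  let ?e = "\<lambda>l. int (min (s r) (s l)) - int (s l - 1)"
  have *: "?e l = 1" if "l \<in> {1..N}" "s l \<le> s r" for l
    using that s_ge_1[OF that(1)] by (simp add: min_def)
  have low: "(\<Prod>l=1..r. p l powi ?e l) = (\<Prod>j=1..r. p j)"
    by (rule prod.cong[OF refl]) (use * s_mono r in force)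
  have "{1..N} = {1..r} \<union> {r+1..N}" using r by auto
  then have split: "(\<Prod>l=1..N. p l powi ?e l) = (\<Prod>l=1..r. p l powi ?e l) * (\<Prod>l=r+1..N. p l powi ?e l)"
    by (simp add: prod.union_disjoint)
  have "(\<Prod>l=r+1..N. p l powi ?e l) = (1 - (\<Prod>l=r+1..N. 1 - p l)) ^ tie s r"
  proof (cases "tie s r = 0")
    case True
    then have "s (r + 1) = s r + 1" using s_step[of r] r by simp
    then have "?e l = 0" if "l \<in> {r+1..N}" for l using s_after[of l] that by auto
    then show ?thesis using True by simp
  next
    case False
    then have "tie s r = 1" by (simp add: tie_def split: if_splits)
    moreover from this have "r + 1 = N" "s (r + 1) = s r" using tie_last s_step[of r] r by auto
    ultimately show ?thesis using *[of N] r by auto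
  qed
  then show ?thesis by (simp only: split low)
qed

text \<open>The three kinds of factors are treated separately; the tie numerator left over at
  \<open>r\<close> is absorbed by \<open>prod_powi_bucket\<close>.\<close>

lemma prod_stage_factor:
  assumes p: "\<And>l. l \<in> {1..N} \<Longrightarrow> 0 < p l \<and> p l \<le> 1"
  shows "(\<Prod>j=1..r. stage_factor p N s j) =
    (\<Prod>l=1..N. p l powi (int (min (s r) (s l)) - int (s l - 1)) * (1 - p l) ^ (s l - 1))
    / (\<Prod>b=1..s r. 1 - (\<Prod>l\<in>{l \<in> {1..N}. b \<le> s l}. 1 - p l))"
proof -
  let ?q = "\<lambda>l. 1 - p l"
  have "(\<Prod>j=1..r. stage_factor p N s j) =
      (\<Prod>j=1..r. p j) * (\<Prod>j=1..r. prod ?q {j+1..N} ^ (1 - tie s j)) *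
      (\<Prod>j=1..r. (1 - prod ?q {j+1..N}) ^ tie s j / (1 - prod ?q {j..N}))"
    by (simp only: stage_factor_def prod.distrib[symmetric] times_divide_eq_right)
  also have "\<dots> = ((\<Prod>j=1..r. p j) * (1 - (\<Prod>l=r+1..N. 1 - p l)) ^ tie s r) *
      (\<Prod>l=1..N. ?q l ^ (s l - 1)) / (\<Prod>b=1..s r. 1 - prod ?q {l \<in> {1..N}. b \<le> s l})"
    by (subst prod_strict_suffix, subst prod_tied_suffix) (use p r in auto)
  finally show ?thesis
    by (simp only: prod_powi_bucket prod.distrib)
qed

end

section \<open>From positions to entities\<close>

text \<open>The conventional value \<open>s m + 1\<close> makes the step at \<open>m\<close> strict
  and all later steps ties when \<open>m < N\<close>. When \<open>m = N\<close>, the last stage is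
  \<open>N - 1\<close>, the one place where a final tie is allowed.\<close>

lemma top_ranking_bucket_sequence:
  assumes "top_ranking E m y s" "card E = N" "2 \<le> N" "1 \<le> m" "m \<le> N"
  shows "bucket_sequence N (m_star N m) s"
proof
  have s: "s 1 = 1" "\<And>j. j \<in> {1..<m} \<Longrightarrow> s (j + 1) = s j \<or> s (j + 1) = s j + 1"
    "\<And>j. j \<in> {m<..N} \<Longrightarrow> s j = s m + 1"
    using assms(1,2) by (auto simp: top_ranking_def)
  show "1 \<le> m_star N m" "m_star N m < N" using assms by (auto simp: m_star_def)
  show "s 1 = 1" by (fact s)
  show tie_after: "tie s j = 1" if "j \<in> {m_star N m<..<N}" for j
    using that s(3)[of j] s(3)[of "j + 1"] by (auto simp: tie_def m_star_def min_def split: if_splits)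
  show "s (j + 1) = s j + (1 - tie s j)" if "j \<in> {1..<N}" for j
  proof -
    consider "j < m" | "j = m" | "m < j" by linarith
    then show ?thesis
      using that s(2)[of j] s(3)[of j] s(3)[of "j + 1"] by cases (auto simp: tie_def)
  qed
  show "m_star N m + 1 = N" if "tie s (m_star N m) \<noteq> 0"
  proof (cases "m < N")
    case True
    then show ?thesis
      using that s(3)[of "m + 1"] by (simp add: tie_def m_star_def min_def split: if_splits)
  next
    case False
    then show ?thesis
      using assms by (simp add: m_star_def)
  qed
qed

lemma power_int_sum:
  fixes x :: "'a :: field"
  assumes "x \<noteq> 0"
  shows "x powi (\<Sum>i\<in>A. f i) = (\<Prod>i\<in>A. x powi f i)"
  by (induction A rule: infinite_finite_induct) (simp_all add: power_int_add assms)

lemma sum_of_bool_le: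
  fixes a b c :: nat
  shows "(\<Sum>j=a..b. of_bool (j \<le> c)) = Suc (min b c) - a"
proof -
  have "(\<Sum>j=a..b. of_bool (j \<le> c)) = card {j \<in> {a..b}. j \<le> c}"
    by (simp add: sum_of_bool_eq Int_def)
  also have "{j \<in> {a..b}. j \<le> c} = {a..min b c}" by auto
  finally show ?thesis by simp
qed

text \<open>The position formula is transported along the bijection \<open>y\<close>. Entities
  outside \<open>E\<close> are never available, so their exponents vanish and the product extends to
  all of \<open>{1..K}\<close>.\<close>

lemma prod_stage_factor_entities:
  fixes \<theta> :: "nat \<Rightarrow> real"
  assumes top: "top_ranking E m y s" and N: "card E = N" "2 \<le> N" and m: "1 \<le> m" "m \<le> N"
    and E: "E \<subseteq> {1..K}" and \<theta>: "\<And>k. k \<in> {1..K} \<Longrightarrow> 0 < \<theta> k \<and> \<theta> k \<le> 1"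
  shows "(\<Prod>j=1..m_star N m. stage_factor (\<lambda>l. \<theta> (y l)) N s j) =
    (\<Prod>k=1..K. \<theta> k powi (int (\<Sum>j=1..num_stages N m s. in_avail N y s j k) - int (\<Sum>j=2..s N. in_avail N y s j k))
       * (1 - \<theta> k) ^ (\<Sum>j=2..s N. in_avail N y s j k))
    / (\<Prod>j=1..num_stages N m s. 1 - (\<Prod>l\<in>avail N y s j. 1 - \<theta> l))"
proof -
  interpret bucket_sequence N "m_star N m" s
    using top_ranking_bucket_sequence[OF top N m] .
  have bij: "bij_betw y {1..N} E" using top N by (simp add: top_ranking_def)
  then have inj: "inj_on y {1..N}" and img: "y ` {1..N} = E" by (auto simp: bij_betw_def)
  have y: "y l \<in> {1..K}" if "l \<in> {1..N}" for l using img E that by blast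
  let ?e = "\<lambda>k. int (\<Sum>j=1..num_stages N m s. in_avail N y s j k) - int (\<Sum>j=2..s N. in_avail N y s j k)"
  let ?d = "\<lambda>k. \<Sum>j=2..s N. in_avail N y s j k"
  have av: "in_avail N y s j (y l) = of_bool (j \<le> s l)" if "l \<in> {1..N}" for j l
    using inj that by (auto simp: in_avail_def avail_def inj_on_eq_iff)
  \<comment> \<open>\<open>y l\<close> is available exactly at the stages up to \<open>s l\<close>;
    counting starts at stage 2, hence \<open>s l - 1\<close>.\<close>
  have d: "?d (y l) = s l - 1" if "l \<in> {1..N}" for l
    using s_mono[of l N] that by (simp add: av sum_of_bool_le min_def)
  have e: "?e (y l) = int (min (num_stages N m s) (s l)) - int (s l - 1)" if "l \<in> {1..N}" for l
    using that by (simp only: d) (simp add: av sum_of_bool_le)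
  have out: "in_avail N y s j k = 0" if "k \<notin> E" for j k
    using that img by (auto simp: in_avail_def avail_def)
  have "(\<Prod>k=1..K. \<theta> k powi ?e k * (1 - \<theta> k) ^ ?d k) = (\<Prod>k\<in>E. \<theta> k powi ?e k * (1 - \<theta> k) ^ ?d k)"
    by (rule prod.mono_neutral_right) (use E out in auto)
  also have "\<dots> = (\<Prod>l=1..N. \<theta> (y l) powi ?e (y l) * (1 - \<theta> (y l)) ^ ?d (y l))"
    by (rule prod.reindex_bij_betw[OF bij, symmetric])
  also have "\<dots> = (\<Prod>l=1..N. \<theta> (y l) powi (int (min (num_stages N m s) (s l)) - int (s l - 1)) * (1 - \<theta> (y l)) ^ (s l - 1))"
    \<comment> \<open>\<open>e\<close> is applied first, since its left side contains that of
      \<open>d\<close>.\<close>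
    by (rule prod.cong[OF refl], simp only: e, simp only: d)
  finally have num: "(\<Prod>k=1..K. \<theta> k powi ?e k * (1 - \<theta> k) ^ ?d k) = \<dots>" .
  have den: "(\<Prod>l\<in>avail N y s j. 1 - \<theta> l) = (\<Prod>l\<in>{l \<in> {1..N}. j \<le> s l}. 1 - \<theta> (y l))" for j
  proof -
    have "avail N y s j = y ` {l \<in> {1..N}. j \<le> s l}" by (auto simp: avail_def)
    moreover have "inj_on y {l \<in> {1..N}. j \<le> s l}" by (rule inj_on_subset[OF inj]) auto
    ultimately show ?thesis by (simp add: prod.reindex)
  qed
  show ?thesis
    unfolding num den unfolding num_stages_def
    by (rule prod_stage_factor) (use y \<theta> in auto)
qed

section \<open>The likelihood as a product over comparisons\<close>

theorem mainTheorem2: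
  fixes M :: "'a measure"
    and W :: "nat \<Rightarrow> nat \<Rightarrow> 'a \<Rightarrow> nat"
    and \<theta> :: "nat \<Rightarrow> real"
    and n K :: nat
    and E :: "nat \<Rightarrow> nat set"
    and N m :: "nat \<Rightarrow> nat"
    and y s :: "nat \<Rightarrow> nat \<Rightarrow> nat"
  assumes "prob_space M"
    and "\<And>k. k \<in> {1..K} \<Longrightarrow> 0 < \<theta> k \<and> \<theta> k \<le> 1"
    and "\<And>i. i \<in> {1..n} \<Longrightarrow> E i \<subseteq> {1..K}"
    and "\<And>i. i \<in> {1..n} \<Longrightarrow> card (E i) = N i \<and> 2 \<le> N i"
    and "\<And>i. i \<in> {1..n} \<Longrightarrow> 1 \<le> m i \<and> m i \<le> N i"
    and "\<And>i. i \<in> {1..n} \<Longrightarrow> top_ranking (E i) (m i) (y i) (s i)"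
    and "prob_space.indep_vars M (\<lambda>_. count_space UNIV) (\<lambda>(i, k). W i k) (SIGMA i:{1..n}. E i)"
    and "\<And>i k. i \<in> {1..n} \<Longrightarrow> k \<in> E i \<Longrightarrow>
           distr M (count_space UNIV) (W i k) = measure_pmf (geom1_pmf (\<theta> k))"
  shows "gpl_likelihood M W n N m y s =
           (\<Prod>i=1..n. \<Prod>j=1..m_star (N i) (m i).
              \<theta> (y i j)
              * (\<Prod>l=j+1..N i. 1 - \<theta> (y i l)) ^ (1 - tie (s i) j)
              * (1 - (\<Prod>l=j+1..N i. 1 - \<theta> (y i l))) ^ tie (s i) j
              / (1 - (\<Prod>l=j..N i. 1 - \<theta> (y i l))))
       \<and> gpl_likelihood M W n N m y s =
           (\<Prod>k=1..K. \<theta> k powi w_exp n N m y s k * (1 - \<theta> k) ^ d_exp n N y s k)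
           / (\<Prod>i=1..n. \<Prod>j=1..num_stages (N i) (m i) (s i).
                1 - (\<Prod>l\<in>avail (N i) (y i) (s i) j. 1 - \<theta> l))"
proof -
  interpret prob_space M by fact
  have cmp: "gpl_prob M (W i) (N i) (m i) (y i) (s i) =
      (\<Prod>j=1..m_star (N i) (m i). stage_factor (\<lambda>l. \<theta> (y i l)) (N i) (s i) j)"
    if i: "i \<in> {1..n}" for i
  proof -
    note E = assms(3)[OF i] and N = assms(4)[OF i] and m = assms(5)[OF i] and top = assms(6)[OF i]
    have bij: "bij_betw (y i) {1..N i} (E i)"
      using top N by (simp add: top_ranking_def)
    then have y: "y i l \<in> E i" if "l \<in> {1..N i}" for l
      using that by (auto simp: bij_betw_def)
    have rv: "W i k \<in> measurable M (count_space UNIV)" if "k \<in> E i" for k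
    proof -
      have "\<forall>x\<in>SIGMA i:{1..n}. E i. random_variable (count_space UNIV) ((\<lambda>(i, k). W i k) x)"
        using assms(7) unfolding indep_vars_def2 by (rule conjunct1)
      from bspec[OF this, of "(i, k)"] show ?thesis using i that by simp
    qed
    have "inj_on (\<lambda>l. (i, y i l)) {1..N i}"
      using bij_betw_imp_inj_on[OF bij] by (auto intro!: inj_onI dest: inj_onD)
    moreover have "(\<lambda>l. (i, y i l)) ` {1..N i} \<subseteq> (SIGMA i:{1..n}. E i)"
      using i y by blast
    ultimately have "indep_vars (\<lambda>_. count_space UNIV) (\<lambda>l. (\<lambda>(i, k). W i k) (i, y i l)) {1..N i}"
      by (rule indep_vars_reindex_inj[OF _ _ assms(7)])
    then have "indep_vars (\<lambda>_. count_space UNIV) (\<lambda>l. W i (y i l)) {1..N i}"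
      by (simp only: prod.case)
    then have "prob {\<omega> \<in> space M. suffix_event (N i) (m i) (s i) 1 (\<lambda>l. W i (y i l) \<omega>)} =
        (\<Prod>j=1..m_star (N i) (m i). stage_factor (\<lambda>l. \<theta> (y i l)) (N i) (s i) j)"
    proof (rule prob_geom_ranking)
      fix l w assume l: "l \<in> {1..N i}"
      show "0 < \<theta> (y i l) \<and> \<theta> (y i l) \<le> 1"
        using assms(2) y[OF l] E by auto
      have "prob {\<omega> \<in> space M. W i (y i l) \<omega> = w} = prob (W i (y i l) -` {w} \<inter> space M)"
        by (simp add: vimage_def Collect_conj_eq Int_commute)
      also have "\<dots> = measure (distr M (count_space UNIV) (W i (y i l))) {w}"
        using rv[OF y[OF l]] by (simp add: measure_distr)
      also have "\<dots> = pmf (geom1_pmf (\<theta> (y i l))) w"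
        using assms(8)[OF i y[OF l]] by (simp add: measure_pmf_single)
      finally show "prob {\<omega> \<in> space M. W i (y i l) \<omega> = w} = pmf (geom1_pmf (\<theta> (y i l))) w" .
    next
      \<comment> \<open>The un-ranked positions carry the index \<open>s m + 1\<close>, so the step
        leaving the reported part is strict.\<close>
      show "s i (m i) \<noteq> s i (m i + 1)" if "m i < N i"
        using top N that by (simp add: top_ranking_def)
    qed (use m in auto)
    then show ?thesis
      by (simp add: gpl_prob_def gpl_event_def suffix_event_def)
  qed
  then have lik: "gpl_likelihood M W n N m y s =
      (\<Prod>i=1..n. \<Prod>j=1..m_star (N i) (m i). stage_factor (\<lambda>l. \<theta> (y i l)) (N i) (s i) j)"
    unfolding gpl_likelihood_def by (rule prod.cong[OF refl])
  let ?d = "\<lambda>i k. \<Sum>j=2..s i (N i). in_avail (N i) (y i) (s i) j k"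
  let ?e = "\<lambda>i k. int (\<Sum>j=1..num_stages (N i) (m i) (s i). in_avail (N i) (y i) (s i) j k) - int (?d i k)"
  let ?R = "\<lambda>i. \<Prod>j=1..num_stages (N i) (m i) (s i). 1 - (\<Prod>l\<in>avail (N i) (y i) (s i) j. 1 - \<theta> l)"
  have "gpl_likelihood M W n N m y s =
      (\<Prod>i=1..n. (\<Prod>k=1..K. \<theta> k powi ?e i k * (1 - \<theta> k) ^ ?d i k) / ?R i)"
    unfolding lik
  proof (rule prod.cong[OF refl])
    fix i assume i: "i \<in> {1..n}"
    show "(\<Prod>j=1..m_star (N i) (m i). stage_factor (\<lambda>l. \<theta> (y i l)) (N i) (s i) j) =
        (\<Prod>k=1..K. \<theta> k powi ?e i k * (1 - \<theta> k) ^ ?d i k) / ?R i"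
      by (rule prod_stage_factor_entities) (use assms(2) assms(3-6)[OF i] in auto)
  qed
  also have "\<dots> = (\<Prod>k=1..K. \<Prod>i=1..n. \<theta> k powi ?e i k * (1 - \<theta> k) ^ ?d i k) / (\<Prod>i=1..n. ?R i)"
    by (simp only: prod_dividef prod.swap[of _ "{1..K}"])
  also have "(\<Prod>k=1..K. \<Prod>i=1..n. \<theta> k powi ?e i k * (1 - \<theta> k) ^ ?d i k) =
      (\<Prod>k=1..K. \<theta> k powi w_exp n N m y s k * (1 - \<theta> k) ^ d_exp n N y s k)"
  proof (rule prod.cong[OF refl])
    fix k assume "k \<in> {1..K}"
    \<comment> \<open>Integer powers add under summation of exponents only for a nonzero base; here
      \<open>0 < \<theta> k\<close> provides it.\<close>
    then have ne: "\<theta> k \<noteq> 0" using assms(2) by force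
    have "w_exp n N m y s k = (\<Sum>i=1..n. ?e i k)"
      by (simp add: w_exp_def d_exp_def sum_subtractf)
    then show "(\<Prod>i=1..n. \<theta> k powi ?e i k * (1 - \<theta> k) ^ ?d i k) =
        \<theta> k powi w_exp n N m y s k * (1 - \<theta> k) ^ d_exp n N y s k"
      by (simp only: prod.distrib power_int_sum[OF ne] power_sum d_exp_def)
  qed
  finally show ?thesis
    using lik by (simp only: stage_factor_def)
qed

end
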